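(* For every integer $s\ge0$, $k(s,2)\le\left\lceil\frac{s}{2}\right\rceil+1$. For every $k\ge1$, the size $s$ of a minimal universal testing set over $\mathbb{Q}$ for tropical polynomials in $2$ variables with at most $k$ monomials satisfies $s\ge2(k-1)+1$.
   Context: A tropical polynomial over $\mathbb{Q}$ in $\vec{x}=(x_1,\dots,x_n)$ is a finite collection of tropical monomials $m_J(\vec{x}) = c_J + j_1x_1+\dots+j_nx_n$ with pairwise distinct exponent vectors $J=(j_1,\dots,j_n)$ and constants $c_J\in\mathbb{Q}$; its value is $p(\vec{x})=\max_J m_J(\vec{x})$. Here the exponents are allowed to be arbitrary rational numbers (this does not affect the quantities below compared with nonnegative integer exponents). A polynomial is nontrivial if it has at least one monomial. A point $\vec{a}\in\mathbb{Q}^n$ is a root of $p$ if the maximum $\max_J m_J(\vec{a})$ is attained on at least two distinct monomials; otherwise it is a non-root. $k(s,n)$ denotes the minimal number such that for any set $S$ of $s$ points in $\mathbb{Q}^n$ there is a nontrivial tropical polynomial over $\mathbb{Q}$ in $n$ variables with at most $k(s,n)$ monomials having roots in all the points of $S$. A universal testing set over $\mathbb{Q}$ for tropical polynomials of $n$ variables with at most $k$ monomials is a finite set $S\subseteq\mathbb{Q}^n$ such that every nontrivial tropical polynomial over $\mathbb{Q}$ in $n$ variables with at most $k$ monomials has a non-root in $S$. *)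

theory Defs
  imports "HOL-Analysis.Analysis"
begin

text \<open>
  The pair \<open>(c, J)\<close> stands for the tropical monomial
  \<open>c + j\<^sub>1 x\<^sub>1 + \<dots> + j\<^sub>n x\<^sub>n\<close>. The index type \<open>'n\<close> carries the number
  of variables, \<open>n = CARD('n)\<close>.
\<close>

type_synonym 'n trop_mono = "rat \<times> (rat ^ 'n)"

definition mono_val :: "'n::finite trop_mono \<Rightarrow> rat ^ 'n \<Rightarrow> rat" where
  "mono_val m x = fst m + (\<Sum>i\<in>UNIV. snd m $ i * x $ i)"

definition trop_poly :: "'n::finite trop_mono set \<Rightarrow> bool" where
  "trop_poly p \<longleftrightarrow> finite p \<and> inj_on snd p"

definition nontrivial :: "'n::finite trop_mono set \<Rightarrow> bool" where
  "nontrivial p \<longleftrightarrow> p \<noteq> {}"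

text \<open>\<open>poly_val p x\<close> is meaningful for nonempty \<open>p\<close> only.\<close>

definition poly_val :: "'n::finite trop_mono set \<Rightarrow> rat ^ 'n \<Rightarrow> rat" where
  "poly_val p x = Max ((\<lambda>m. mono_val m x) ` p)"

definition trop_root :: "'n::finite trop_mono set \<Rightarrow> rat ^ 'n \<Rightarrow> bool" where
  "trop_root p a \<longleftrightarrow>
     (\<exists>m\<in>p. \<exists>m'\<in>p. m \<noteq> m' \<and> mono_val m a = poly_val p a \<and> mono_val m' a = poly_val p a)"

text \<open>
  \<open>min_monomials TYPE('n) s\<close> is \<open>k(s, n)\<close> for \<open>n = CARD('n)\<close>.
\<close>

definition min_monomials :: "'n::finite itself \<Rightarrow> nat \<Rightarrow> nat" where
  "min_monomials _ s =
     (LEAST k. \<forall>S :: (rat ^ 'n) set. finite S \<and> card S = s \<longrightarrow>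
        (\<exists>p. trop_poly p \<and> nontrivial p \<and> card p \<le> k \<and> (\<forall>a\<in>S. trop_root p a)))"

definition universal_testing_set :: "nat \<Rightarrow> (rat ^ 'n::finite) set \<Rightarrow> bool" where
  "universal_testing_set k S \<longleftrightarrow> finite S \<and>
     (\<forall>p. trop_poly p \<and> nontrivial p \<and> card p \<le> k \<longrightarrow> (\<exists>a\<in>S. \<not> trop_root p a))"

definition min_testing_size :: "'n::finite itself \<Rightarrow> nat \<Rightarrow> nat" where
  "min_testing_size _ k =
     (LEAST s. \<exists>S :: (rat ^ 'n) set. universal_testing_set k S \<and> card S = s)"

end

theory Submission
  imports Defs
begin

text \<open>
  The upper bound on \<open>k(s, 2)\<close> holds because one further monomial buys roots at two further points.
  Suppose that \<open>P\<close> has roots at all points of \<open>S\<close> but \<open>p\<close> and \<open>q\<close>. A monomial that agrees with \<open>P\<close>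
  at \<open>p\<close> and \<open>q\<close> makes both of them roots when it is adjoined to \<open>P\<close>; it preserves the other
  roots as long as it does not exceed \<open>P\<close> there. Such a monomial is prescribed on the line through
  \<open>p\<close> and \<open>q\<close>, but its slope across that line is free. If the line supports the convex hull of
  \<open>S\<close>, a sufficiently steep slope pushes the monomial below \<open>P\<close> at all points off the line
  (\<open>adjoin_roots_at_boundary_pair\<close>). On the line the monomial is a chord of the convex function
  \<open>P\<close>, hence below \<open>P\<close> outside the segment from \<open>p\<close> to \<open>q\<close>, so \<open>p\<close> and \<open>q\<close> only have to be
  neighbours (\<open>poly_val_extrapolation\<close>). An edge of the hull always contains
  such a pair (\<open>ex_boundary_pair\<close>). Stripping off one pair after the other leaves at most one
  point, which costs one or two monomials (\<open>ex_trop_poly_with_roots\<close>).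

  The lower bound on testing sets is the contrapositive: with at most \<open>2 * (k - 1)\<close> points, the
  interpolating polynomial has at most \<open>k\<close> monomials and defeats the set. As the minimal size is
  a least number, it also has to be shown that some universal testing set exists
  (\<open>ex_universal_testing_set\<close>): the roots of a polynomial lie on the finitely many lines where two
  of its monomials agree, and these cannot cover many points of a parabola.
\<close>

section \<open>The pairing of exponents and points\<close>

definition dot :: "rat ^ 'n::finite \<Rightarrow> rat ^ 'n \<Rightarrow> rat" where
  "dot u x = (\<Sum>i\<in>UNIV. u $ i * x $ i)"

lemma mono_val_eq_dot: "mono_val m x = fst m + dot (snd m) x"
  by (simp add: mono_val_def dot_def)

lemma dot_diff: "dot u (x - y) = dot u x - dot u y"
  by (simp add: dot_def algebra_simps sum_subtractf)

lemma dot_scale: "dot u (c *s x) = c * dot u x"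
  by (simp add: dot_def sum_distrib_left mult_ac)

lemma dot_diff_left: "dot (u - v) x = dot u x - dot v x"
  by (simp add: dot_def algebra_simps sum_subtractf)

lemma dot_scale_left: "dot (c *s u) x = c * dot u x"
  by (simp add: dot_def sum_distrib_left mult_ac)

lemmas dot_linear = dot_diff dot_scale dot_diff_left dot_scale_left

lemma dot_self_nonzero:
  assumes "w \<noteq> 0"
  shows "dot w w \<noteq> 0"
proof
  assume "dot w w = 0"
  then have "\<forall>i. w $ i * w $ i = 0"
    by (simp add: dot_def sum_nonneg_eq_0_iff)
  with assms show False
    by (simp add: vec_eq_iff)
qed

lemma dot_2: "dot u x = u $ 1 * x $ 1 + u $ 2 * x $ 2" for u x :: "rat ^ 2"
  by (simp add: dot_def sum_2)

section \<open>Adjoining a monomial to a tropical polynomial\<close>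

lemma mono_val_le_poly_val:
  assumes "finite P" "m \<in> P"
  shows "mono_val m x \<le> poly_val P x"
  using assms by (simp add: poly_val_def)

lemma poly_val_attained:
  assumes "finite P" "P \<noteq> {}"
  obtains m where "m \<in> P" "mono_val m x = poly_val P x"
proof -
  have "poly_val P x \<in> (\<lambda>m. mono_val m x) ` P"
    unfolding poly_val_def using assms by (intro Max_in) auto
  with that show thesis by auto
qed

lemma poly_val_insert_below:
  assumes "finite P" "P \<noteq> {}" "mono_val m x \<le> poly_val P x"
  shows "poly_val (insert m P) x = poly_val P x"
  using assms by (simp add: poly_val_def)

lemma trop_root_insert_below:
  assumes "finite P" "P \<noteq> {}" "mono_val m x \<le> poly_val P x" "trop_root P x"
  shows "trop_root (insert m P) x"
  using assms(4) unfolding trop_root_def poly_val_insert_below[OF assms(1-3)] by blast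

lemma trop_root_insert_tie:
  assumes "finite P" "P \<noteq> {}" "mono_val m x = poly_val P x" "m \<notin> P"
  shows "trop_root (insert m P) x"
proof -
  obtain m' where "m' \<in> P" "mono_val m' x = poly_val P x"
    using poly_val_attained assms(1,2) by blast
  with assms show ?thesis
    unfolding trop_root_def by (auto simp: poly_val_insert_below)
qed

text \<open>
  A tropical polynomial is a convex function, so beyond \<open>q\<close> its graph lies above the line through
  its values at \<open>p\<close> and \<open>q\<close>.
\<close>

lemma poly_val_extrapolation:
  assumes "finite P" "P \<noteq> {}" "t \<ge> 1" "r - p = t *s (q - p)"
  shows "poly_val P p + t * (poly_val P q - poly_val P p) \<le> poly_val P r"
proof -
  obtain m where m: "m \<in> P" "mono_val m q = poly_val P q"
    using poly_val_attained assms(1,2) by blast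
  have "dot (snd m) (r - p) = t * dot (snd m) (q - p)"
    unfolding assms(4) by (rule dot_scale)
  then have "mono_val m r = mono_val m p + t * (mono_val m q - mono_val m p)"
    by (simp add: mono_val_eq_dot dot_diff)
  moreover have "(t - 1) * mono_val m p \<le> (t - 1) * poly_val P p"
    using assms m by (intro mult_left_mono mono_val_le_poly_val) auto
  ultimately show ?thesis
    using mono_val_le_poly_val[OF assms(1) m(1), of r] m(2) by (simp add: algebra_simps)
qed

text \<open>
  \<open>p\<close> and \<open>q\<close> are neighbouring points of \<open>S\<close> on a supporting line of \<open>S\<close> (or hyperplane, in higher
  dimension) with inner normal \<open>u\<close>, and \<open>p\<close> is an end point.
\<close>

definition boundary_pair ::
  "(rat ^ 'n::finite) set \<Rightarrow> rat ^ 'n \<Rightarrow> rat ^ 'n \<Rightarrow> rat ^ 'n \<Rightarrow> bool" where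
  "boundary_pair S u p q \<longleftrightarrow> u \<noteq> 0 \<and> p \<in> S \<and> q \<in> S \<and> p \<noteq> q \<and> dot u (q - p) = 0 \<and>
     (\<forall>r\<in>S - {p}. dot u (r - p) > 0 \<or> (\<exists>t\<ge>1. r - p = t *s (q - p)))"

text \<open>
  One monomial suffices to create roots at both points of a boundary pair. It agrees with \<open>P\<close> at
  \<open>p\<close> and \<open>q\<close> and falls steeply into the side of the supporting line that contains the rest of
  \<open>S\<close>, so that it stays below \<open>P\<close> there; on the line itself convexity of \<open>P\<close> keeps it below.
\<close>

lemma adjoin_roots_at_boundary_pair:
  fixes P :: "'n::finite trop_mono set"
  assumes P: "trop_poly P" "P \<noteq> {}" and S: "finite S" and pq: "boundary_pair S u p q"
  obtains m where "trop_poly (insert m P)"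
    and "trop_root (insert m P) p" "trop_root (insert m P) q"
    and "\<And>r. r \<in> S \<Longrightarrow> trop_root P r \<Longrightarrow> trop_root (insert m P) r"
proof -
  have fin: "finite P" and inj: "inj_on snd P"
    using P(1) by (auto simp: trop_poly_def)
  obtain i where i: "u $ i \<noteq> 0"
    using pq by (auto simp: boundary_pair_def vec_eq_iff)
  define w where "w = q - p"
  define v where "v = ((poly_val P q - poly_val P p) / dot w w) *s w"
  have "dot w w \<noteq> 0"
    using pq by (intro dot_self_nonzero) (auto simp: boundary_pair_def w_def)
  then have v: "dot v w = poly_val P q - poly_val P p"
    by (simp add: v_def dot_scale_left)
  have uw: "dot u w = 0"
    using pq by (simp add: boundary_pair_def w_def)
  \<comment> \<open>The steepness \<open>l\<close> has to exceed one bound for each point of \<open>S\<close> off the line and, to make the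
    exponent vector \<open>v - l *s u\<close> new, the only candidate that coordinate \<open>i\<close> leaves for each exponent
    vector of \<open>P\<close>. Points on the line contribute the harmless bound 0, as division by 0 gives 0.\<close>
  define F where "F = (\<lambda>r. (poly_val P p + dot v (r - p) - poly_val P r) / dot u (r - p)) ` S
    \<union> (\<lambda>m. (v $ i - snd m $ i) / u $ i) ` P"
  have "finite F"
    using S fin by (simp add: F_def)
  define l where "l = Max (insert 0 F) + 1"
  have l: "b < l" if "b \<in> F" for b
  proof -
    have "b \<le> Max (insert 0 F)"
      using \<open>finite F\<close> that by (intro Max_ge) auto
    then show ?thesis by (simp add: l_def)
  qed
  define m :: "'n trop_mono" where
    "m = (poly_val P p - dot (v - l *s u) p, v - l *s u)"
  have m_val: "mono_val m x = poly_val P p + dot v (x - p) - l * dot u (x - p)" for x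
    by (simp add: m_def mono_val_eq_dot dot_linear algebra_simps)
  have new: "snd m \<notin> snd ` P"
  proof
    assume "snd m \<in> snd ` P"
    then obtain m' where m': "m' \<in> P" "snd m' = v - l *s u"
      by (auto simp: m_def)
    then have "(v $ i - snd m' $ i) / u $ i = l"
      using i by simp
    moreover have "(v $ i - snd m' $ i) / u $ i \<in> F"
      using m'(1) unfolding F_def by blast
    ultimately show False
      using l by fastforce
  qed
  have at_p: "mono_val m p = poly_val P p"
    by (simp add: m_val dot_def)
  have at_q: "mono_val m q = poly_val P q"
    using v uw by (simp add: m_val w_def)
  have below: "mono_val m r \<le> poly_val P r" if "r \<in> S" for r
  proof (cases "r = p")
    case True
    then show ?thesis using at_p by simp
  next
    case False
    then consider "dot u (r - p) > 0" | t where "t \<ge> 1" "r - p = t *s w"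
      using pq \<open>r \<in> S\<close> unfolding boundary_pair_def w_def by blast
    then show ?thesis
    proof cases
      case 1
      have "(poly_val P p + dot v (r - p) - poly_val P r) / dot u (r - p) < l"
        using that by (intro l) (simp add: F_def)
      with 1 show ?thesis
        by (simp add: m_val divide_less_eq)
    next
      case 2
      then have "mono_val m r = poly_val P p + t * (poly_val P q - poly_val P p)"
        by (simp add: m_val dot_scale v uw)
      then show ?thesis
        using poly_val_extrapolation[OF fin P(2)] 2 by (simp add: w_def)
    qed
  qed
  show thesis
  proof (rule that[of m])
    show "trop_poly (insert m P)"
      using fin inj new by (auto simp: trop_poly_def)
    have "m \<notin> P" using new by auto
    then show "trop_root (insert m P) p" "trop_root (insert m P) q"
      using at_p at_q fin P(2) by (simp_all add: trop_root_insert_tie)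
    show "trop_root (insert m P) r" if "r \<in> S" "trop_root P r" for r
      using below fin P(2) that by (simp add: trop_root_insert_below)
  qed
qed

section \<open>Interpolation of roots in the plane\<close>

lemma ex_injective_linear_functional:
  fixes S :: "(rat ^ 2) set"
  assumes "finite S"
  obtains e where "inj_on (dot (vector [1, e])) S"
proof -
  define B where "B = (\<lambda>(x, y). - (x $ 1 - y $ 1) / (x $ 2 - y $ 2)) ` (S \<times> S)"
  have "finite B"
    using assms by (simp add: B_def)
  then obtain e where e: "e \<notin> B"
    using ex_new_if_finite[OF infinite_UNIV_char_0] by blast
  have "inj_on (dot (vector [1, e])) S"
  proof
    fix x y assume xy: "x \<in> S" "y \<in> S" "dot (vector [1, e]) x = dot (vector [1, e]) y"
    then have *: "(x $ 1 - y $ 1) + e * (x $ 2 - y $ 2) = 0"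
      by (simp add: dot_2 algebra_simps)
    have "x $ 2 = y $ 2"
    proof (rule ccontr)
      assume "x $ 2 \<noteq> y $ 2"
      then have "e = - (x $ 1 - y $ 1) / (x $ 2 - y $ 2)"
        using * by (simp add: field_simps)
      then have "e \<in> B"
        using xy(1,2) unfolding B_def by (intro image_eqI[of _ _ "(x, y)"]) auto
      with e show False ..
    qed
    with * show "x = y" by (simp add: vec_eq_iff forall_2)
  qed
  with that show thesis .
qed

text \<open>
  The first step of gift wrapping: from an extreme point \<open>p\<close>, take the direction of largest slope,
  and on the ray in this direction the point nearest to \<open>p\<close>.
\<close>

lemma ex_boundary_pair:
  fixes S :: "(rat ^ 2) set"
  assumes "finite S" "card S \<ge> 2"
  obtains u p q where "boundary_pair S u p q"
proof -
  obtain e where e: "inj_on (dot (vector [1, e])) S"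
    using ex_injective_linear_functional assms(1) .
  define g :: "rat ^ 2 \<Rightarrow> rat" where "g = dot (vector [1, e])"
  have "S \<noteq> {}" using assms by auto
  then obtain p where p: "p \<in> S" "\<And>r. r \<in> S \<Longrightarrow> g p \<le> g r"
    using assms(1) arg_min_if_finite[of S g] by (metis not_le)
  have pos: "g (r - p) > 0" if "r \<in> S - {p}" for r
  proof -
    have "g p \<noteq> g r"
      using that p(1) e by (auto simp: g_def dest: inj_onD)
    with p(2)[of r] that show ?thesis
      by (simp add: g_def dot_diff)
  qed
  define slope where "slope = (\<lambda>r. (r - p) $ 2 / g (r - p))"
  define \<sigma> where "\<sigma> = Max (slope ` (S - {p}))"
  have "S - {p} \<noteq> {}"
  proof
    assume "S - {p} = {}"
    then have "S \<subseteq> {p}" by auto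
    then have "card S \<le> 1" 
      using card_mono[of "{p}" S] by simp
    with assms(2) show False by simp
  qed
  then have "\<sigma> \<in> slope ` (S - {p})"
    unfolding \<sigma>_def using assms(1) by (intro Max_in) auto
  define T where "T = {r \<in> S - {p}. slope r = \<sigma>}"
  have "finite T" "T \<noteq> {}"
    using assms(1) \<open>\<sigma> \<in> slope ` (S - {p})\<close> by (auto simp: T_def)
  then obtain q where q: "q \<in> T" "\<And>r. r \<in> T \<Longrightarrow> g q \<le> g r"
    using arg_min_if_finite[of T g] by (metis not_le)
  define u :: "rat ^ 2" where "u = vector [\<sigma>, \<sigma> * e - 1]"
  have u_eq: "dot u x = \<sigma> * g x - x $ 2" for x
    by (simp add: u_def g_def dot_2 algebra_simps)
  have qS: "q \<in> S" "q \<noteq> p" "slope q = \<sigma>"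
    using q by (auto simp: T_def)
  have "boundary_pair S u p q"
    unfolding boundary_pair_def
  proof (intro conjI ballI)
    show "u \<noteq> 0"
      by (auto simp: u_def vec_eq_iff forall_2)
    show "dot u (q - p) = 0"
      using qS pos[of q] by (simp add: u_eq slope_def field_simps)
    fix r assume r: "r \<in> S - {p}"
    show "dot u (r - p) > 0 \<or> (\<exists>t\<ge>1. r - p = t *s (q - p))"
    proof (cases "r \<in> T")
      case False
      have "slope r \<le> \<sigma>"
        unfolding \<sigma>_def using assms(1) r by (intro Max_ge) auto
      with False r have "slope r < \<sigma>"
        by (auto simp: T_def)
      then show ?thesis
        using pos[OF r] by (simp add: u_eq slope_def divide_less_eq)
    next
      case True
      define t where "t = g (r - p) / g (q - p)"
      have gq: "g (q - p) > 0"
        using pos qS by simp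
      have "g (q - p) \<le> g (r - p)"
        using q(2)[OF True] by (simp add: g_def dot_diff)
      then have "t \<ge> 1"
        using gq by (simp add: t_def)
      moreover have "r - p = t *s (q - p)"
      proof -
        have "g (r - p) = t * g (q - p)"
          using gq by (simp add: t_def)
        moreover have "(r - p) $ 2 = \<sigma> * g (r - p)" "(q - p) $ 2 = \<sigma> * g (q - p)"
          using True qS gq pos[OF r] by (auto simp: T_def slope_def field_simps)
        ultimately have two: "(r - p) $ 2 = t * (q - p) $ 2"
          and "g (r - p) = t * g (q - p)" by simp_all
        then have "(r - p) $ 1 + e * (r - p) $ 2 = t * (q - p) $ 1 + e * (t * (q - p) $ 2)"
          by (simp add: g_def dot_2 algebra_simps)
        with two have "(r - p) $ 1 = t * (q - p) $ 1" by simp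
        with two show ?thesis
          by (simp add: vec_eq_iff forall_2 right_diff_distrib)
      qed
      ultimately show ?thesis by blast
    qed
  qed (use p qS in auto)
  with that show thesis .
qed

lemma ex_trop_poly_with_roots:
  fixes S :: "(rat ^ 2) set"
  assumes "finite S"
  shows "\<exists>P. trop_poly P \<and> nontrivial P \<and> card P \<le> (card S + 1) div 2 + 1 \<and>
           (\<forall>a\<in>S. trop_root P a)"
  using assms
proof (induction "card S" arbitrary: S rule: less_induct)
  case less
  consider "S = {}" | a where "S = {a}" | "card S \<ge> 2"
  proof -
    have "card S = 0 \<or> card S = 1 \<or> card S \<ge> 2"
      by linarith
    with that show thesis
      using less.prems by (auto simp: card_1_singleton_iff)
  qed
  then show ?case
  proof cases
    case 1
    then show ?thesis
      by (intro exI[of _ "{(0, 0)}"]) (simp add: trop_poly_def nontrivial_def)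
  next
    case 2
    define m m' :: "2 trop_mono" where "m = (0, 0)" and "m' = (- (a $ 1), axis 1 1)"
    have "snd m' \<noteq> snd m"
      by (simp add: m_def m'_def axis_eq_0_iff)
    moreover have "mono_val m' a = poly_val {m} a"
      by (simp add: m_def m'_def poly_val_def mono_val_eq_dot dot_2 axis_def)
    then have "trop_root {m', m} a"
      by (rule trop_root_insert_tie[rotated 2]) (use calculation in auto)
    ultimately show ?thesis
      using 2 by (intro exI[of _ "{m', m}"]) (auto simp: trop_poly_def nontrivial_def card_insert_if)
  next
    case 3
    obtain u p q where pq: "boundary_pair S u p q"
      using ex_boundary_pair less.prems 3 .
    then have "p \<in> S" "q \<in> S" "p \<noteq> q"
      by (auto simp: boundary_pair_def)
    then have card: "card (S - {p, q}) = card S - 2"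
      using less.prems by (simp add: card_Diff_subset)
    then have "card (S - {p, q}) < card S"
      using 3 by simp
    then obtain P where P: "trop_poly P" "nontrivial P" "card P \<le> (card (S - {p, q}) + 1) div 2 + 1"
      "\<forall>a\<in>S - {p, q}. trop_root P a"
      using less.hyps less.prems by blast
    then have "P \<noteq> {}" by (simp add: nontrivial_def)
    then obtain m where m: "trop_poly (insert m P)"
      "trop_root (insert m P) p" "trop_root (insert m P) q"
      "\<And>r. r \<in> S \<Longrightarrow> trop_root P r \<Longrightarrow> trop_root (insert m P) r"
      using adjoin_roots_at_boundary_pair[OF P(1) _ less.prems pq] by metis
    have "card (insert m P) \<le> Suc (card P)"
      by (rule card_insert_le_m1) auto
    also have "\<dots> \<le> (card S + 1) div 2 + 1"
      using P(3) 3 unfolding card by simp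
    finally show ?thesis
      using m P(4) by (intro exI[of _ "insert m P"]) (auto simp: nontrivial_def)
  qed
qed

lemma min_monomials_2_le: "min_monomials TYPE(2) s \<le> (s + 1) div 2 + 1"
  unfolding min_monomials_def
proof (intro Least_le allI impI)
  fix S :: "(rat ^ 2) set"
  assume "finite S \<and> card S = s"
  then show "\<exists>P. trop_poly P \<and> nontrivial P \<and> card P \<le> (s + 1) div 2 + 1 \<and> (\<forall>a\<in>S. trop_root P a)"
    using ex_trop_poly_with_roots[of S] by blast
qed

section \<open>Universal testing sets\<close>

text \<open>
  A point of the parabola lies on the line on which two given monomials agree only if its
  first coordinate is a root of a nonzero quadratic polynomial.
\<close>

lemma card_parabola_tie_le_2:
  fixes m m' :: "2 trop_mono"
  assumes "snd m \<noteq> snd m'"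
  defines "Z \<equiv> {t. mono_val m (vector [t, t\<^sup>2]) = mono_val m' (vector [t, t\<^sup>2])}"
  shows "finite Z \<and> card Z \<le> 2"
proof -
  define f where "f = [:fst m - fst m', snd m $ 1 - snd m' $ 1, snd m $ 2 - snd m' $ 2:]"
  have "f \<noteq> 0"
    using assms(1) by (auto simp: f_def vec_eq_iff forall_2)
  moreover have "Z = {t. poly f t = 0}"
    by (auto simp: Z_def f_def mono_val_eq_dot dot_2 algebra_simps power2_eq_square)
  moreover have "degree f \<le> 2"
    by (simp add: f_def)
  ultimately show ?thesis
    using poly_roots_finite[of f] card_poly_roots_bound[of f] by auto
qed

text \<open>
  A polynomial with at most \<open>k\<close> monomials has all its roots on at most \<open>k\<^sup>2\<close> lines, each of
  which meets the parabola at most twice, so more than \<open>2 * k\<^sup>2\<close> points of the parabola suffice.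
\<close>

lemma ex_universal_testing_set: "\<exists>S :: (rat ^ 2) set. universal_testing_set k S"
proof -
  define T where "T = (of_nat ` {..2 * (k * k)} :: rat set)"
  define S :: "(rat ^ 2) set" where "S = (\<lambda>t. vector [t, t\<^sup>2]) ` T"
  have "universal_testing_set k S"
    unfolding universal_testing_set_def
  proof (intro conjI allI impI)
    show "finite S" by (simp add: S_def T_def)
    fix P :: "2 trop_mono set"
    assume P: "trop_poly P \<and> nontrivial P \<and> card P \<le> k"
    then have fin: "finite P" and inj: "inj_on snd P" and cardP: "card P \<le> k"
      by (auto simp: trop_poly_def)
    define D where "D = {(m, m') \<in> P \<times> P. m \<noteq> m'}"
    define Z where "Z = (\<lambda>(m :: 2 trop_mono, m' :: 2 trop_mono).
      {t. mono_val m (vector [t, t\<^sup>2]) = mono_val m' (vector [t, t\<^sup>2])})"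
    have D: "finite D" "card D \<le> k * k"
    proof -
      have "D \<subseteq> P \<times> P" by (auto simp: D_def)
      then have "finite D" and "card D \<le> card (P \<times> P)"
        using fin by (blast intro: finite_subset card_mono finite_SigmaI)+
      moreover have "card (P \<times> P) \<le> k * k"
        using cardP by (simp add: card_cartesian_product mult_mono)
      ultimately show "finite D" "card D \<le> k * k" by auto
    qed
    have Z: "finite (Z d) \<and> card (Z d) \<le> 2" if "d \<in> D" for d
    proof -
      obtain m m' where d: "d = (m, m')" "m \<in> P" "m' \<in> P" "m \<noteq> m'"
        using \<open>d \<in> D\<close> unfolding D_def by blast
      then have "snd m \<noteq> snd m'"
        using inj by (auto dest: inj_onD)
      then show ?thesis
        using card_parabola_tie_le_2 d(1) by (simp add: Z_def)
    qed
    show "\<exists>a\<in>S. \<not> trop_root P a"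
    proof (rule ccontr)
      assume "\<not> (\<exists>a\<in>S. \<not> trop_root P a)"
      then have roots: "trop_root P (vector [t, t\<^sup>2])" if "t \<in> T" for t
        using that by (auto simp: S_def)
      have "T \<subseteq> (\<Union>d\<in>D. Z d)"
      proof
        fix t assume "t \<in> T"
        from roots[OF this] obtain m m' where "m \<in> P" "m' \<in> P" "m \<noteq> m'"
          "mono_val m (vector [t, t\<^sup>2]) = mono_val m' (vector [t, t\<^sup>2])"
          unfolding trop_root_def by metis
        then show "t \<in> (\<Union>d\<in>D. Z d)"
          by (intro UN_I[of "(m, m')"]) (auto simp: D_def Z_def)
      qed
      then have "card T \<le> card (\<Union>d\<in>D. Z d)"
        using D Z by (intro card_mono) auto
      also have "\<dots> \<le> (\<Sum>d\<in>D. card (Z d))"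
        using D by (intro card_UN_le)
      also have "\<dots> \<le> card D * 2"
        using Z sum_bounded_above[of D "\<lambda>d. card (Z d)" 2] by simp
      also have "\<dots> \<le> 2 * (k * k)"
        using D by simp
      finally show False
        by (simp add: T_def card_image inj_on_def)
    qed
  qed
  then show ?thesis by blast
qed

lemma universal_testing_set_card_ge:
  fixes S :: "(rat ^ 2) set"
  assumes "k \<ge> 1" "universal_testing_set k S"
  shows "card S \<ge> 2 * (k - 1) + 1"
proof (rule ccontr)
  assume "\<not> ?thesis"
  then have "(card S + 1) div 2 + 1 \<le> k"
    using assms(1) by linarith
  moreover have "finite S"
    using assms(2) by (simp add: universal_testing_set_def)
  then obtain P where "trop_poly P" "nontrivial P" "card P \<le> (card S + 1) div 2 + 1"
    "\<forall>a\<in>S. trop_root P a"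
    using ex_trop_poly_with_roots by blast
  ultimately show False
    using assms(2) unfolding universal_testing_set_def by fastforce
qed

theorem theorem12:
  shows "(\<forall>s::nat. int (min_monomials TYPE(2) s) \<le> \<lceil>real s / 2\<rceil> + 1) \<and>
         (\<forall>k::nat. k \<ge> 1 \<longrightarrow> min_testing_size TYPE(2) k \<ge> 2 * (k - 1) + 1)"
proof (intro conjI allI impI)
  fix s :: nat
  have "int ((s + 1) div 2) = \<lceil>real s / 2\<rceil>"
    by linarith
  then show "int (min_monomials TYPE(2) s) \<le> \<lceil>real s / 2\<rceil> + 1"
    using min_monomials_2_le[of s] by linarith
next
  fix k :: nat assume k: "k \<ge> 1"
  have "\<exists>s. \<exists>S :: (rat ^ 2) set. universal_testing_set k S \<and> card S = s"
    using ex_universal_testing_set by blast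
  then have "\<exists>S :: (rat ^ 2) set. universal_testing_set k S \<and> card S = min_testing_size TYPE(2) k"
    unfolding min_testing_size_def by (rule LeastI_ex)
  then show "min_testing_size TYPE(2) k \<ge> 2 * (k - 1) + 1"
    using universal_testing_set_card_ge k by metis
qed

end
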